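(* There exist rank-one transformations that are zero-type but not rationally weakly mixing.
   Context: Rank-one transformations. A column is a finite ordered collection of pairwise disjoint intervals of $\mathbb{R}$ (called levels), all of the same length, thought of as stacked on top of each other. The column map $T_C$ of a column $C$ sends each point of a level other than the top one to the point directly above it in the next level (by translation); it is undefined on the top level. A rank-one (cutting-and-stacking) transformation $T$ is given by a sequence of columns $C_n$, $n\ge 0$: $C_0$ consists of the single level $I=(0,1)$; $C_{n+1}$ is obtained from $C_n$ by cutting $C_n$ into $r_n\ge 2$ subcolumns of equal width (numbered $0,\dots,r_n-1$ from left to right), adding $s_{n,k}\ge 0$ new levels ("spacers", new disjoint intervals) above the $k$-th subcolumn, and stacking every subcolumn under the subcolumn to its right. $X$ is the union of all levels of all columns, with Lebesgue measure $\mu$ and its Borel $\sigma$-algebra, and the levels are required to form a generating semiring for the $\sigma$-algebra. $T_{C_{n+1}}$ extends $T_{C_n}$, and $T$ is the limit of the $T_{C_n}$; it is an invertible measure-preserving transformation of $X$ (mod null sets). $T$ is zero-type if $\mu(A\cap T^nA)\to 0$ as $n\to\infty$ for all measurable sets $A$ of finite measure. For measurable $F$ with $0<\mu(F)<\infty$, $u_k(F)=\mu(F\cap T^kF)/\mu(F)^2$ and $a_n(F)=\sum_{k=0}^{n-1}u_k(F)$. $T$ is rationally weakly mixing if there exists a measurable $F\subset X$ with $0<\mu(F)<\infty$ such that for all measurable $A,B\subset F$, $$\frac{1}{a_n(F)}\sum_{k=0}^{n-1}\left|\mu(A\cap T^kB)-\mu(A)\mu(B)u_k(F)\right|\to 0\quad\text{as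 } n\to\infty.$$ *)

theory Defs
  imports "HOL-Analysis.Analysis"
begin

text \<open>
  A column is given by the common width of its levels and the list of their left endpoints,
  ordered from bottom to top. Levels are open intervals, so cutting a column discards the finitely
  many cut points. Accordingly a rank-one transformation is determined by its column maps
  only outside a countable set.
\<close>

datatype column = Column (width: real) (bases: "real list")

definition height :: "column \<Rightarrow> nat" where
  "height C = length (bases C)"

definition level :: "column \<Rightarrow> nat \<Rightarrow> real set" where
  "level C j = {bases C ! j <..< bases C ! j + width C}"

definition is_column :: "column \<Rightarrow> bool" where
  "is_column C \<longleftrightarrow> 0 < width C \<and> 0 < height C \<and> disjoint_family_on (level C) {..<height C}"

text \<open>The column map is a partial map, represented by its graph.\<close>

definition column_map :: "column \<Rightarrow> (real \<times> real) set" where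
  "column_map C =
     {(x, x + (bases C ! Suc j - bases C ! j)) | x j. Suc j < height C \<and> x \<in> level C j}"

definition subcolumn_bases :: "column \<Rightarrow> nat \<Rightarrow> nat \<Rightarrow> real list" where
  "subcolumn_bases C r k = map (\<lambda>a. a + real k * (width C / real r)) (bases C)"

text \<open>
  \<open>sp k\<close> lists the left endpoints of the spacers put above the \<open>k\<close>-th subcolumn.
\<close>

definition cut_and_stack :: "column \<Rightarrow> nat \<Rightarrow> (nat \<Rightarrow> real list) \<Rightarrow> column" where
  "cut_and_stack C r sp =
     Column (width C / real r) (concat (map (\<lambda>k. subcolumn_bases C r k @ sp k) [0..<r]))"

text \<open>
  Disjointness of the spacers from each other and from the old levels is part of
  \<open>is_column (C (Suc n))\<close>.
\<close>

definition cutting_and_stacking ::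
    "(nat \<Rightarrow> nat) \<Rightarrow> (nat \<Rightarrow> nat \<Rightarrow> nat) \<Rightarrow> (nat \<Rightarrow> column) \<Rightarrow> bool" where
  "cutting_and_stacking r s C \<longleftrightarrow>
     C 0 = Column 1 [0] \<and>
     (\<forall>n. is_column (C n)) \<and>
     (\<forall>n. 2 \<le> r n) \<and>
     (\<forall>n. \<exists>sp. (\<forall>k<r n. length (sp k) = s n k) \<and> C (Suc n) = cut_and_stack (C n) (r n) sp)"

definition levels :: "(nat \<Rightarrow> column) \<Rightarrow> real set set" where
  "levels C = {level (C n) j | n j. j < height (C n)}"

definition endpoints :: "(nat \<Rightarrow> column) \<Rightarrow> real set" where
  "endpoints C = (\<Union>n. set (bases (C n)) \<union> (\<lambda>a. a + width (C n)) ` set (bases (C n)))"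

text \<open>
  Because levels are open, they form a generating semiring up to null sets: exactly so
  once the countably many endpoints of levels are removed.
\<close>

definition generating_semiring :: "(nat \<Rightarrow> column) \<Rightarrow> bool" where
  "generating_semiring C \<longleftrightarrow>
     (let X = \<Union>(levels C) - endpoints C; L = (\<lambda>I. I - endpoints C) ` levels C in
        semiring_of_sets X (insert {} L) \<and>
        sigma_sets X L = sets (restrict_space borel X))"

text \<open>
  \<open>T\<close> is the common extension of all column maps. These leave it undetermined only at
  countably many points of \<open>X\<close> (cut points, and points eventually staying in top levels),
  where its values in \<open>X\<close> are arbitrary. In particular \<open>T\<close> is, up to a countable set, an injective
  countable union of translations, and forward images of Borel subsets of \<open>X\<close> are Borel.
\<close>

definition rank_one_transformation :: "real set \<Rightarrow> (real \<Rightarrow> real) \<Rightarrow> bool" where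
  "rank_one_transformation X T \<longleftrightarrow>
     (\<exists>r s C. cutting_and_stacking r s C \<and> generating_semiring C \<and>
        X = \<Union>(levels C) \<and> T \<in> X \<rightarrow> X \<and>
        (\<forall>n. \<forall>(x, y) \<in> column_map (C n). T x = y))"

text \<open>
  The following notions are meant for transformations that are invertible and measure
  preserving modulo null sets, with measurable forward images.
\<close>

definition zero_type :: "'a measure \<Rightarrow> ('a \<Rightarrow> 'a) \<Rightarrow> bool" where
  "zero_type M T \<longleftrightarrow>
     (\<forall>A \<in> sets M. emeasure M A < \<infinity> \<longrightarrow>
        (\<lambda>n. measure M (A \<inter> (T ^^ n) ` A)) \<longlonglongrightarrow> 0)"

definition u_seq :: "'a measure \<Rightarrow> ('a \<Rightarrow> 'a) \<Rightarrow> 'a set \<Rightarrow> nat \<Rightarrow> real" where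
  "u_seq M T F k = measure M (F \<inter> (T ^^ k) ` F) / (measure M F)\<^sup>2"

definition a_seq :: "'a measure \<Rightarrow> ('a \<Rightarrow> 'a) \<Rightarrow> 'a set \<Rightarrow> nat \<Rightarrow> real" where
  "a_seq M T F n = (\<Sum>k<n. u_seq M T F k)"

definition rationally_weakly_mixing :: "'a measure \<Rightarrow> ('a \<Rightarrow> 'a) \<Rightarrow> bool" where
  "rationally_weakly_mixing M T \<longleftrightarrow>
     (\<exists>F \<in> sets M. 0 < emeasure M F \<and> emeasure M F < \<infinity> \<and>
        (\<forall>A \<in> sets M. \<forall>B \<in> sets M. A \<subseteq> F \<longrightarrow> B \<subseteq> F \<longrightarrow>
           (\<lambda>n. 1 / a_seq M T F n *
                (\<Sum>k<n. \<bar>measure M (A \<inter> (T ^^ k) ` B)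
                         - measure M A * measure M B * u_seq M T F k\<bar>)) \<longlonglongrightarrow> 0))"

end

theory Submission
  imports Defs
begin

text \<open>
  With \<open>h\<^sub>0 = 1\<close>, cut the column \<open>C\<^sub>m\<close> of height \<open>h\<^sub>m\<close> into \<open>r\<^sub>m = (m + 2) h\<^sub>m\<close> subcolumns and put
  \<open>h\<^sub>m (2 \<cdot> 3\<^sup>k - 1)\<close> spacers above the \<open>k\<close>-th one, so that in \<open>C\<^sub>m\<^sub>+\<^sub>1\<close> it starts at height
  \<open>h\<^sub>m (3\<^sup>k - 1)\<close>.

  All these heights are multiples of \<open>h\<^sub>m\<close>, and every \<open>h\<^sub>N\<close> divides all later heights. Hence \<open>T\<^sup>k\<close>
  takes points of the \<open>j\<close>-th level of \<open>C\<^sub>N\<close> to the \<open>i\<close>-th one only if \<open>h\<^sub>N\<close> divides \<open>j + k - i\<close>. A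
  set \<open>F\<close> of positive measure meets two distinct levels of some \<open>C\<^sub>N\<close> in sets \<open>A\<close>, \<open>B\<close> of positive
  measure, and for every \<open>k\<close> one of \<open>A \<inter> T\<^sup>k A\<close>, \<open>A \<inter> T\<^sup>k B\<close> is null. The two averages for the
  pairs \<open>(A, A)\<close> and \<open>(A, B)\<close> therefore add up to at least a positive constant.

  Let \<open>Y\<^sub>m\<close> be the union of the levels of \<open>C\<^sub>m\<close>. If \<open>h\<^sub>m \<le> n < h\<^sub>m\<^sub>+\<^sub>1\<close>, a point of \<open>Y\<^sub>m\<close> returning to \<open>Y\<^sub>m\<close>
  after \<open>n\<close> steps moves from subcolumn \<open>k\<close> to a subcolumn \<open>l\<close> with \<open>\<bar>h\<^sub>m (3\<^sup>l - 3\<^sup>k) - n\<bar> < h\<^sub>m\<close>. This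
  allows at most two values of \<open>k\<close>, because a positive difference of powers of 3 determines both
  powers. As \<open>r\<^sub>m\<close> exceeds \<open>m h\<^sub>m\<close>, each subcolumn has measure at most \<open>1 / (m + 1)\<close>, so the
  measure of \<open>Y\<^sub>m \<inter> T\<^sup>n Y\<^sub>m\<close> tends to 0.
\<close>

section \<open>Block lists, piecewise translations, and differences of powers of three\<close>

lemma nth_concat_map_upt:
  assumes "k < r" and "p < length (f k)"
  shows "concat (map f [0..<r]) ! ((\<Sum>j<k. length (f j)) + p) = f k ! p"
  using assms
proof (induction r)
  case (Suc r)
  have len: "length (concat (map f [0..<r])) = (\<Sum>j<r. length (f j))" for r
    by (induction r) auto
  show ?case
  proof (cases "k = r")
    case True
    then show ?thesis using Suc.prems by (simp add: nth_append len[symmetric])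
  next
    case False
    then have k: "k < r" using Suc.prems by simp
    have "(\<Sum>j<k. length (f j)) + p < (\<Sum>j<Suc k. length (f j))"
      using Suc.prems by simp
    also have "\<dots> \<le> (\<Sum>j<r. length (f j))"
      using k by (intro sum_mono2) auto
    finally show ?thesis using Suc k by (simp add: nth_append len)
  qed
qed simp

text \<open>Once the pieces are made disjoint, each moves by a single translation, while the part of
  \<open>Z\<close> in \<open>D\<close> has a countable, hence null, image. Images of different
  pieces may overlap, so the measure is only bounded from above. This serves for forward images
  under \<open>T\<close>.\<close>

lemma piecewise_translation_image:
  fixes T :: "real \<Rightarrow> real" and P :: "nat \<Rightarrow> real set"
  assumes D: "countable D" and P: "\<And>i. P i \<in> sets borel"
    and T: "\<And>i x. x \<in> P i \<Longrightarrow> T x = x + c i"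
    and Z: "Z \<in> sets borel" "Z \<subseteq> D \<union> (\<Union>i. P i)"
  shows "T ` Z \<in> sets borel" "emeasure lborel (T ` Z) \<le> emeasure lborel Z"
proof -
  define Q where "Q i = Z \<inter> disjointed P i" for i
  have Qm: "Q i \<in> sets borel" for i
    using Z P sets.range_disjointed_sets[of P borel] unfolding Q_def by blast
  have disj: "disjoint_family Q"
    using disjoint_family_disjointed[of P] unfolding Q_def disjoint_family_on_def by blast
  have TQ: "T ` Q i = (+) (c i) ` Q i" for i
    using T disjointed_subset[of P i] unfolding Q_def by (force simp: add.commute image_iff)
  have TQm: "T ` Q i \<in> sets borel" for i
  proof -
    have "T ` Q i = (\<lambda>x. x - c i) -` Q i"
      unfolding TQ by (auto simp: image_iff) (metis add.commute diff_add_cancel)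
    then show ?thesis
      using measurable_sets_borel[of "\<lambda>x. x - c i" borel "Q i"] Qm[of i] by simp
  qed
  have TQe: "emeasure lborel (T ` Q i) = emeasure lborel (Q i)" for i
  proof -
    have "emeasure lborel (T ` Q i) = emeasure (distr lborel borel ((+) (c i))) (T ` Q i)"
      by (simp add: lborel_distr_plus)
    also have "\<dots> = emeasure lborel ((+) (c i) -` (T ` Q i))"
      using TQm by (subst emeasure_distr) auto
    also have "(+) (c i) -` (T ` Q i) = Q i"
      unfolding TQ by auto
    finally show ?thesis .
  qed
  have "(\<Union>i. Q i) = Z \<inter> (\<Union>i. P i)"
    unfolding Q_def Int_UN_distrib[symmetric] UN_disjointed_eq ..
  then have "Z = (Z \<inter> D) \<union> (\<Union>i. Q i)" using Z(2) by auto
  then have split: "T ` Z = T ` (Z \<inter> D) \<union> (\<Union>i. T ` Q i)"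
    by (metis image_UN image_Un)
  have cnt: "countable (T ` (Z \<inter> D))" using D by (simp add: countable_Int2)
  then have cm: "T ` (Z \<inter> D) \<in> sets borel" and c0: "emeasure lborel (T ` (Z \<inter> D)) = 0"
    using emeasure_lborel_countable sets.countable[of "T ` (Z \<inter> D)" borel] by auto
  show "T ` Z \<in> sets borel" unfolding split using cm TQm by auto
  have "emeasure lborel (T ` Z) \<le> emeasure lborel (T ` (Z \<inter> D)) + emeasure lborel (\<Union>i. T ` Q i)"
    unfolding split by (rule emeasure_subadditive) (use cm TQm in auto)
  also have "\<dots> \<le> (\<Sum>i. emeasure lborel (T ` Q i))"
    unfolding c0 using TQm by (auto intro!: emeasure_subadditive_countably)
  also have "\<dots> = emeasure lborel (\<Union>i. Q i)"
    unfolding TQe using Qm disj by (intro suminf_emeasure) auto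
  also have "\<dots> \<le> emeasure lborel Z"
    by (intro emeasure_mono) (use Z Q_def in auto)
  finally show "emeasure lborel (T ` Z) \<le> emeasure lborel Z" .
qed

text \<open>If \<open>b < d\<close>, then \<open>3 ^ Suc b\<close> divides the other three powers
  and hence \<open>3 ^ b\<close>, which is absurd; the case \<open>d < b\<close> is
  symmetric.\<close>

lemma three_power_diff_inject:
  assumes eq: "3 ^ a - 3 ^ b = (3 ^ c - 3 ^ d :: int)" and pos: "0 < (3 ^ a - 3 ^ b :: int)"
  shows "b = d"
proof -
  have no: False if "(3::int) ^ a - 3 ^ b = 3 ^ c - 3 ^ d" "0 < (3::int) ^ a - 3 ^ b" "b < d"
    for a b c d :: nat
  proof -
    have "b < a" using that power_less_imp_less_exp[of "3::int" b a] by linarith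
    have "d < c" using that power_less_imp_less_exp[of "3::int" d c] by linarith
    have "(3::int) ^ Suc b dvd 3 ^ a" "(3::int) ^ Suc b dvd 3 ^ c" "(3::int) ^ Suc b dvd 3 ^ d"
      using \<open>b < a\<close> \<open>d < c\<close> that by (auto intro!: le_imp_power_dvd simp del: power_Suc)
    moreover have "(3::int) ^ b = 3 ^ a - 3 ^ c + 3 ^ d" using that by simp
    ultimately have "(3::int) ^ Suc b dvd 3 ^ b" by (simp del: power_Suc)
    then have "\<bar>(3::int) ^ Suc b\<bar> \<le> \<bar>3 ^ b\<bar>" by (intro dvd_imp_le_int) auto
    then show False by simp
  qed
  show ?thesis using no[OF eq pos] no[OF eq[symmetric]] pos eq by (metis linorder_less_linear)
qed

section \<open>The columns\<close>

text \<open>The exponent is the number of cuts, written out because \<open>cuts\<close> is itself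
  defined from \<open>hgt\<close>. The value is the height at which one further subcolumn would
  start.\<close>

primrec hgt :: "nat \<Rightarrow> nat" where
  "hgt 0 = 1"
| "hgt (Suc m) = hgt m * (3 ^ ((m + 2) * hgt m) - 1)"

definition cuts :: "nat \<Rightarrow> nat" where
  "cuts m = (m + 2) * hgt m"

text \<open>
  Spacers are taken immediately to the right of the existing levels: up to cut points, \<open>C\<^sub>m\<close> fills
  the interval \<open>(0, hgt m / den m)\<close>, and its levels are the cells \<open>(i / den m, (i + 1) / den m)\<close> in
  the order given by \<open>level_index m\<close>.
\<close>

definition den :: "nat \<Rightarrow> nat" where
  "den m = (\<Prod>i<m. cuts i)"

definition spacers :: "nat \<Rightarrow> nat \<Rightarrow> nat" where
  "spacers m k = hgt m * (2 * 3 ^ k - 1)"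

text \<open>The refined old cells use up the indices below \<open>hgt m * cuts m\<close>; the
  spacers take the indices after them, one subcolumn after the other.\<close>

definition spacer_index :: "nat \<Rightarrow> nat \<Rightarrow> nat" where
  "spacer_index m k = hgt m * cuts m + (\<Sum>j<k. spacers m j)"

text \<open>Cell \<open>a\<close> of stage \<open>m\<close> splits into the cells
  \<open>a * cuts m + k\<close> of stage \<open>Suc m\<close>, and the \<open>k\<close>-th of them
  goes to the \<open>k\<close>-th subcolumn.\<close>

primrec level_index :: "nat \<Rightarrow> nat list" where
  "level_index 0 = [0]"
| "level_index (Suc m) = concat (map (\<lambda>k. map (\<lambda>a. a * cuts m + k) (level_index m)
       @ [spacer_index m k ..< spacer_index m (Suc k)]) [0..<cuts m])"

definition col :: "nat \<Rightarrow> column" where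
  "col m = Column (1 / den m) (map (\<lambda>i. real i / den m) (level_index m))"

definition start :: "nat \<Rightarrow> nat \<Rightarrow> nat" where
  "start m k = hgt m * (3 ^ k - 1)"

definition cell :: "nat \<Rightarrow> nat \<Rightarrow> real set" where
  "cell m i = {real i / den m <..< (real i + 1) / den m}"

lemma hgt_pos [simp]: "0 < hgt m"
proof (induction m)
  case (Suc m)
  have "(3::nat) ^ 1 \<le> 3 ^ ((m + 2) * hgt m)"
    using Suc by (intro power_increasing) (auto simp: Suc_le_eq)
  then show ?case using Suc by simp
qed simp

declare hgt.simps(2) [simp del]

lemma cuts_ge_2: "2 \<le> cuts m"
proof -
  have "2 * 1 \<le> (m + 2) * hgt m" using hgt_pos[of m] by (intro mult_le_mono) (auto simp: Suc_le_eq simp del: hgt_pos)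
  then show ?thesis by (simp add: cuts_def)
qed

lemma cuts_pos [simp]: "0 < cuts m"
  using cuts_ge_2[of m] by simp

lemma hgt_Suc: "hgt (Suc m) = start m (cuts m)"
  by (simp add: start_def cuts_def hgt.simps)

lemma den_0 [simp]: "den 0 = 1"
  by (simp add: den_def)

lemma den_Suc: "den (Suc m) = den m * cuts m"
  by (simp add: den_def)

lemma den_pos [simp]: "0 < den m"
  unfolding den_def by (intro prod_pos) auto

lemma start_Suc: "start m (Suc k) = start m k + 2 * 3 ^ k * hgt m"
proof -
  have "(1::nat) \<le> 3 ^ k" by simp
  then obtain t where "(3::nat) ^ k = t + 1" using le_Suc_ex by (metis add.commute)
  then show ?thesis by (simp add: start_def algebra_simps)
qed

lemma start_Suc_spacers: "start m (Suc k) = start m k + (hgt m + spacers m k)"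
proof -
  have "(1::nat) \<le> 3 ^ k" by simp
  then obtain t where "(3::nat) ^ k = t + 1" using le_Suc_ex by (metis add.commute)
  then show ?thesis by (simp add: start_Suc spacers_def algebra_simps)
qed

lemma start_mono: "k \<le> l \<Longrightarrow> start m k \<le> start m l"
  by (simp add: start_def diff_le_mono)

lemma start_eq_sum: "start m k = (\<Sum>j<k. hgt m + spacers m j)"
  by (induction k) (auto simp: start_Suc_spacers, simp add: start_def)

lemma start_gap:
  assumes "k < l"
  shows "start m k + 2 * hgt m \<le> start m l"
proof -
  have "2 * hgt m \<le> 2 * 3 ^ k * hgt m" by (intro mult_le_mono) auto
  then have "start m k + 2 * hgt m \<le> start m (Suc k)" unfolding start_Suc by linarith
  also have "\<dots> \<le> start m l" using assms by (intro start_mono) simp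
  finally show ?thesis .
qed

lemma start_add_hgt: "k < cuts m \<Longrightarrow> start m k + 2 * hgt m \<le> hgt (Suc m)"
  unfolding hgt_Suc by (rule start_gap)

lemma spacer_index_Suc: "spacer_index m (Suc k) = spacer_index m k + spacers m k"
  by (simp add: spacer_index_def)

lemma spacer_index_cuts: "spacer_index m (cuts m) = hgt (Suc m)"
  unfolding hgt_Suc start_eq_sum spacer_index_def by (simp add: sum.distrib)

lemma hgt_cuts_le: "hgt m * cuts m \<le> hgt (Suc m)"
  unfolding spacer_index_cuts[symmetric] by (simp add: spacer_index_def)

lemma length_level_index [simp]: "length (level_index m) = hgt m"
proof (induction m)
  case (Suc m)
  then show ?case
    by (simp add: length_concat comp_def spacer_index_Suc hgt_Suc start_eq_sum
        interv_sum_list_conv_sum_set_nat atLeast0LessThan)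
qed simp

lemma nat_digits_Un: "(\<Union>k<r. (\<lambda>a. a * r + k) ` {..<h}) = {..<h * r}" if "0 < r" for r h :: nat
proof (intro equalityI subsetI)
  fix x assume "x \<in> {..<h * r}"
  then have "x div r < h" "x mod r < r" using that by (auto simp: less_mult_imp_div_less)
  then show "x \<in> (\<Union>k<r. (\<lambda>a. a * r + k) ` {..<h})"
    by (intro UN_I[of "x mod r"] image_eqI[of _ _ "x div r"]) auto
next
  fix x assume "x \<in> (\<Union>k<r. (\<lambda>a. a * r + k) ` {..<h})"
  then obtain a k where *: "a < h" "k < r" "x = a * r + k" by auto
  then have "x < Suc a * r" by simp
  also have "\<dots> \<le> h * r" using * by (intro mult_le_mono) auto
  finally show "x \<in> {..<h * r}" by simp
qed

text \<open>By division with remainder the refined old cells fill an initial segment, and the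
  abutting spacer ranges continue it up to \<open>hgt (Suc m)\<close>. So no stage leaves a
  gap.\<close>

lemma set_level_index: "set (level_index m) = {..<hgt m}"
proof (induction m)
  case (Suc m)
  have iv: "(\<Union>k<r. {spacer_index m k ..< spacer_index m (Suc k)})
      = {spacer_index m 0 ..< spacer_index m r}" for r
  proof (induction r)
    case (Suc r)
    have "spacer_index m 0 \<le> spacer_index m r" by (simp add: spacer_index_def)
    then show ?case
      unfolding lessThan_Suc UN_insert Suc by (auto simp: spacer_index_Suc)
  qed simp
  have "set (level_index (Suc m)) = (\<Union>k<cuts m. (\<lambda>a. a * cuts m + k) ` {..<hgt m})
      \<union> (\<Union>k<cuts m. {spacer_index m k ..< spacer_index m (Suc k)})"
    by (simp add: Suc UN_Un_distrib atLeast0LessThan)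
  also have "\<dots> = {..<hgt m * cuts m} \<union> {hgt m * cuts m ..< hgt (Suc m)}"
    unfolding iv spacer_index_cuts by (simp add: nat_digits_Un spacer_index_def)
  also have "\<dots> = {..<hgt (Suc m)}" using hgt_cuts_le[of m] by auto
  finally show ?case .
qed auto

lemma distinct_level_index: "distinct (level_index m)"
  by (rule card_distinct) (simp add: set_level_index)

lemma level_index_less: "p < hgt m \<Longrightarrow> level_index m ! p < hgt m"
  using nth_mem[of p "level_index m"] by (simp add: set_level_index)

text \<open>Each subcolumn survives as a contiguous block of the next column: the lengths of the
  preceding blocks, spacers included, add up to \<open>start m k\<close>.\<close>

lemma level_index_block:
  assumes "k < cuts m" and "p < hgt m"
  shows "level_index (Suc m) ! (start m k + p) = level_index m ! p * cuts m + k"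
proof -
  let ?f = "\<lambda>k. map (\<lambda>a. a * cuts m + k) (level_index m) @ [spacer_index m k ..< spacer_index m (Suc k)]"
  have "(\<Sum>j<k. length (?f j)) = start m k"
    unfolding start_eq_sum by (simp add: spacer_index_Suc)
  then show ?thesis
    using nth_concat_map_upt[of k "cuts m" p ?f] assms by (simp add: nth_append)
qed

lemma width_col [simp]: "width (col m) = 1 / den m"
  by (simp add: col_def)

lemma height_col [simp]: "height (col m) = hgt m"
  by (simp add: col_def height_def)

lemma nth_bases_col: "p < hgt m \<Longrightarrow> bases (col m) ! p = real (level_index m ! p) / den m"
  by (simp add: col_def)

lemma level_col: "p < hgt m \<Longrightarrow> level (col m) p = cell m (level_index m ! p)"
  by (simp add: level_def nth_bases_col cell_def add_divide_distrib)

lemma in_cell_iff: "x \<in> cell m i \<longleftrightarrow> real i < x * den m \<and> x * den m < real i + 1"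
  by (auto simp: cell_def field_simps)

lemma cell_unique: "x \<in> cell m i \<Longrightarrow> x \<in> cell m j \<Longrightarrow> i = j"
  by (auto simp: in_cell_iff)

lemma level_col_unique:
  assumes "x \<in> level (col m) p" "x \<in> level (col m) q" "p < hgt m" "q < hgt m"
  shows "p = q"
proof -
  have "level_index m ! p = level_index m ! q"
    using assms by (intro cell_unique[of x m]) (auto simp: level_col)
  then show ?thesis using assms distinct_level_index[of m] by (simp add: nth_eq_iff_index_eq)
qed

lemma cell_not_int: "x \<in> cell m i \<Longrightarrow> x * den m \<notin> \<int>"
proof
  assume "x \<in> cell m i" "x * den m \<in> \<int>"
  then obtain z :: int where "real_of_int (int i) < of_int z" "of_int z < real_of_int (int i + 1)"
    by (auto simp: in_cell_iff elim!: Ints_cases)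
  then show False unfolding of_int_less_iff by linarith
qed

lemma is_column_col: "is_column (col m)"
  unfolding is_column_def disjoint_family_on_def
  using level_col_unique[of _ m] by auto

lemma cut_and_stack_col:
  "col (Suc m) = cut_and_stack (col m) (cuts m)
     (\<lambda>k. map (\<lambda>i. real i / den (Suc m)) [spacer_index m k ..< spacer_index m (Suc k)])"
proof -
  have 1: "subcolumn_bases (col m) (cuts m) k
      = map (\<lambda>i. real i / den (Suc m)) (map (\<lambda>a. a * cuts m + k) (level_index m))" for k
    using cuts_pos[of m] den_pos[of m]
    by (simp add: subcolumn_bases_def col_def den_Suc field_simps del: cuts_pos den_pos)
  show ?thesis
    unfolding cut_and_stack_def 1
    by (simp add: col_def den_Suc map_concat comp_def del: map_map map_append upt_Suc)
      (simp add: comp_def)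
qed

lemma cutting_and_stacking_col: "cutting_and_stacking cuts spacers col"
  unfolding cutting_and_stacking_def
proof (intro conjI allI)
  show "col 0 = Column 1 [0]" by (simp add: col_def)
  show "is_column (col n)" for n by (rule is_column_col)
  show "2 \<le> cuts n" for n by (rule cuts_ge_2)
  show "\<exists>sp. (\<forall>k<cuts n. length (sp k) = spacers n k) \<and> col (Suc n) = cut_and_stack (col n) (cuts n) sp"
    for n
    by (rule exI, rule conjI[OF _ cut_and_stack_col]) (simp add: spacer_index_Suc)
qed

section \<open>Cut points and the refinement of levels\<close>

text \<open>The grids of all scales are gathered in one countable set. A positive point outside it
  lies in a cell at every scale, so a single exceptional set serves for all columns.\<close>

definition cut_points :: "real set" where
  "cut_points = {x. \<exists>m. x * den m \<in> \<int>}"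

text \<open>The right end of the interval that \<open>col m\<close> fills up to cut points.\<close>

definition reach :: "nat \<Rightarrow> real" where
  "reach m = hgt m / den m"

lemma countable_cut_points: "countable cut_points"
proof -
  have "cut_points \<subseteq> (\<Union>m. (\<lambda>z. z / den m) ` \<int>)"
  proof
    fix x assume "x \<in> cut_points"
    then obtain m where m: "x * den m \<in> \<int>" by (auto simp: cut_points_def)
    have "x = x * den m / den m" using den_pos[of m] by simp
    with m show "x \<in> (\<Union>m. (\<lambda>z. z / den m) ` \<int>)" by blast
  qed
  moreover have "countable (\<Union>m. (\<lambda>z. z / real (den m)) ` (\<int> :: real set))"
    using countable_int by auto
  ultimately show ?thesis by (rule countable_subset)
qed

lemma not_cut_point: "x \<notin> cut_points \<Longrightarrow> x * den m \<notin> \<int>"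
  by (auto simp: cut_points_def)

lemma den_dvd_mono: "m \<le> n \<Longrightarrow> den m dvd den n"
  by (induction n rule: dec_induct) (auto simp: den_Suc)

lemma den_int_mono:
  fixes x :: real
  shows "m \<le> n \<Longrightarrow> x * den m \<in> \<int> \<Longrightarrow> x * den n \<in> \<int>"
  using den_dvd_mono[of m n] by (auto simp: mult.assoc[symmetric])

lemma hgt_dvd_mono: "m \<le> n \<Longrightarrow> hgt m dvd hgt n"
  by (induction n rule: dec_induct) (auto simp: hgt.simps)

lemma less_hgt: "m < hgt m"
proof (induction m)
  case (Suc m)
  have "hgt m * 2 \<le> hgt m * cuts m" using cuts_ge_2 by simp
  also have "\<dots> \<le> hgt (Suc m)" by (rule hgt_cuts_le)
  finally show ?case using Suc by simp
qed simp

lemma less_den: "m < den m"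
proof (induction m)
  case (Suc m)
  have "den m * 2 \<le> den m * cuts m" using cuts_ge_2 by simp
  then show ?case using Suc unfolding den_Suc by linarith
qed simp

lemma reach_mono: "m \<le> n \<Longrightarrow> reach m \<le> reach n"
proof (rule lift_Suc_mono_le[of reach])
  fix m
  have "real (hgt m * cuts m) \<le> hgt (Suc m)" using hgt_cuts_le of_nat_mono by blast
  then have "real (hgt m * cuts m) / den (Suc m) \<le> hgt (Suc m) / den (Suc m)"
    by (intro divide_right_mono) auto
  then show "reach m \<le> reach (Suc m)" by (simp add: reach_def den_Suc)
qed

lemma cell_subset_reach: "i < hgt m \<Longrightarrow> cell m i \<subseteq> {0<..<reach m}"
proof
  fix x assume i: "i < hgt m" and "x \<in> cell m i"
  then have x: "real i < x * den m" "x * den m < real i + 1" by (auto simp: in_cell_iff)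
  have "0 < x * den m" using x(1) by linarith
  moreover have "x * den m < hgt m" using x(2) i by linarith
  ultimately show "x \<in> {0<..<reach m}"
    using den_pos[of m] by (simp add: reach_def field_simps zero_less_mult_iff del: den_pos)
qed

lemma in_some_cell:
  fixes x :: real
  assumes "0 < x" "x * den m \<notin> \<int>"
  obtains i where "x \<in> cell m i" "real i \<le> x * den m"
proof -
  define i where "i = nat \<lfloor>x * den m\<rfloor>"
  have "0 \<le> x * den m" using assms by simp
  then have ri: "real i = of_int \<lfloor>x * den m\<rfloor>" by (simp add: i_def)
  moreover have "of_int \<lfloor>x * den m\<rfloor> \<noteq> x * den m" using assms(2) by (metis Ints_of_int)
  ultimately have "real i < x * den m" "x * den m < real i + 1"
    using of_int_floor_le[of "x * den m"] floor_correct[of "x * den m"] by linarith+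
  then show ?thesis using that[of i] by (simp add: in_cell_iff)
qed

lemma in_some_cell_below:
  fixes x :: real
  assumes "0 < x" "x * den m \<notin> \<int>" "x < reach m"
  obtains i where "i < hgt m" "x \<in> cell m i"
proof -
  obtain i where i: "x \<in> cell m i" "real i \<le> x * den m" using in_some_cell assms by blast
  have "x * den m < hgt m" using assms(3) den_pos[of m] by (simp add: reach_def field_simps del: den_pos)
  then show ?thesis using that[of i] i by simp
qed

lemma level_index_onto: "i < hgt m \<Longrightarrow> \<exists>p<hgt m. level_index m ! p = i"
  using set_level_index[of m] by (metis in_set_conv_nth length_level_index lessThan_iff)

lemma levels_col: "levels col = {cell m i | m i. i < hgt m}"
proof (intro equalityI subsetI)
  fix S assume "S \<in> levels col"
  then obtain n j where "S = level (col n) j" "j < hgt n" by (auto simp: levels_def)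
  then show "S \<in> {cell m i | m i. i < hgt m}" using level_col level_index_less by blast
next
  fix S assume "S \<in> {cell m i | m i. i < hgt m}"
  then obtain m i where S: "S = cell m i" "i < hgt m" by auto
  then obtain p where "p < hgt m" "level_index m ! p = i" using level_index_onto by blast
  then show "S \<in> levels col" using S level_col[of p m] by (auto simp: levels_def)
qed

lemma in_some_level:
  fixes x :: real
  assumes "0 < x" "x * den m \<notin> \<int>" "x < reach m"
  obtains p where "p < hgt m" "x \<in> level (col m) p"
  using in_some_cell_below[OF assms] level_index_onto level_col by metis

lemma level_subset_reach: "p < hgt m \<Longrightarrow> level (col m) p \<subseteq> {0<..<reach m}"
  using level_col cell_subset_reach level_index_less by metis

lemma level_not_int: "x \<in> level (col m) p \<Longrightarrow> p < hgt m \<Longrightarrow> x * den m \<notin> \<int>"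
  using level_col cell_not_int by metis

lemma bases_col_Suc:
  assumes "k < cuts m" "p < hgt m"
  shows "bases (col (Suc m)) ! (start m k + p) = bases (col m) ! p + real k / den (Suc m)"
proof -
  have "start m k + p < hgt (Suc m)" using start_add_hgt[OF assms(1)] assms(2) by simp
  then have "bases (col (Suc m)) ! (start m k + p) = real (level_index m ! p * cuts m + k) / den (Suc m)"
    unfolding level_index_block[OF assms, symmetric] by (rule nth_bases_col)
  then show ?thesis
    using assms den_pos[of m] cuts_pos[of m]
    by (simp add: nth_bases_col den_Suc field_simps del: den_pos cuts_pos)
qed

text \<open>The index of the next finer cell around \<open>x\<close>, divided by
  \<open>cuts m\<close>, has the index of the old cell as quotient; the remainder is the number of
  the subcolumn.\<close>

lemma level_refine:
  assumes x: "x \<in> level (col m) p" "p < hgt m" and nz: "x * den (Suc m) \<notin> \<int>"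
  obtains k where "k < cuts m" "x \<in> level (col (Suc m)) (start m k + p)"
proof -
  define i where "i = level_index m ! p"
  have i: "real i < x * den m" "x * den m < real i + 1"
    using x by (auto simp: level_col in_cell_iff i_def)
  have "0 < x" using x level_subset_reach by fastforce
  then obtain l where l: "x \<in> cell (Suc m) l" using in_some_cell nz by blast
  have "x * den m * cuts m < (real i + 1) * cuts m" "real i * cuts m < x * den m * cuts m"
    using i by (intro mult_strict_right_mono; simp)+
  moreover have "x * den m * cuts m < real l + 1" "real l < x * den m * cuts m"
    using l by (simp_all add: in_cell_iff den_Suc mult.assoc)
  ultimately have "real i * cuts m < real l + 1" "real l < (real i + 1) * cuts m" by linarith+
  then have "real (i * cuts m) < real (l + 1)" "real l < real ((i + 1) * cuts m)"
    by (simp_all add: distrib_right)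
  then have il: "i * cuts m \<le> l" "l < i * cuts m + cuts m" unfolding of_nat_less_iff by simp_all
  define k where "k = l - i * cuts m"
  have k: "k < cuts m" "l = i * cuts m + k" using il by (auto simp: k_def)
  have "start m k + p < hgt (Suc m)" using start_add_hgt[OF k(1)] x(2) by simp
  then have "x \<in> level (col (Suc m)) (start m k + p)"
    using l k x(2) by (simp add: level_col level_index_block i_def del: level_index.simps)
  with k(1) show ?thesis by (rule that)
qed

text \<open>Along with \<open>x\<close>, a whole translated copy of \<open>col m\<close> is followed
  into \<open>col n\<close>. Each refinement adds a subcolumn start, a multiple of
  \<open>hgt m\<close>, to the position \<open>c\<close> and a horizontal shift to \<open>t\<close>.
  Divisibility of \<open>c\<close> is for the return times, the common shift for the consistency of
  the column maps.\<close>

lemma block_in_later: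
  assumes x: "x \<in> level (col m) p" "p < hgt m" and "m \<le> n" and nz: "x * den n \<notin> \<int>"
  shows "\<exists>c t. hgt m dvd c \<and> c + hgt m \<le> hgt n \<and>
    (\<forall>j<hgt m. bases (col n) ! (c + j) = bases (col m) ! j + t) \<and> x \<in> level (col n) (c + p)"
  using \<open>m \<le> n\<close> nz
proof (induction n rule: dec_induct)
  case base
  show ?case by (rule exI[of _ 0], rule exI[of _ 0]) (use x in auto)
next
  case (step n)
  have "x * den n \<notin> \<int>" using step.prems den_int_mono[of n "Suc n" x] by auto
  then obtain c t where ct: "hgt m dvd c" "c + hgt m \<le> hgt n"
      "\<And>j. j < hgt m \<Longrightarrow> bases (col n) ! (c + j) = bases (col m) ! j + t"
      "x \<in> level (col n) (c + p)"
    using step.IH by blast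
  have "c + p < hgt n" using ct x by simp
  then obtain k where k: "k < cuts n" "x \<in> level (col (Suc n)) (start n k + (c + p))"
    using level_refine ct(4) step.prems by blast
  have "hgt m dvd start n k + c"
    using ct(1) hgt_dvd_mono[OF step.hyps(1)] by (auto simp: start_def)
  moreover have "start n k + c + hgt m \<le> hgt (Suc n)" using start_add_hgt[OF k(1)] ct(2) by simp
  moreover have "bases (col (Suc n)) ! (start n k + c + j) = bases (col m) ! j + (t + real k / den (Suc n))"
    if "j < hgt m" for j
    using bases_col_Suc[OF k(1), of "c + j"] ct(2) ct(3)[OF that] that by (simp add: add.assoc)
  ultimately show ?case using k(2) by (metis add.assoc)
qed

lemma column_map_col:
  "(x, y) \<in> column_map (col n) \<longleftrightarrow>
     (\<exists>p. Suc p < hgt n \<and> x \<in> level (col n) p \<and> y = x + (bases (col n) ! Suc p - bases (col n) ! p))"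
  by (auto simp: column_map_def)

text \<open>In the later column, the two levels concerned belong to one translated copy of the
  earlier column, and the shift cancels in the difference of their bases.\<close>

lemma column_map_col_consistent:
  assumes "(x, y) \<in> column_map (col m)" "(x, z) \<in> column_map (col n)"
  shows "y = z"
proof -
  have *: "y = z" if xy: "(x, y) \<in> column_map (col m)" and xz: "(x, z) \<in> column_map (col n)" and "m \<le> n"
    for m n y z
  proof -
    obtain p where p: "Suc p < hgt m" "x \<in> level (col m) p" "y = x + (bases (col m) ! Suc p - bases (col m) ! p)"
      using xy column_map_col by blast
    obtain q where q: "Suc q < hgt n" "x \<in> level (col n) q" "z = x + (bases (col n) ! Suc q - bases (col n) ! q)"
      using xz column_map_col by blast
    have "x * den n \<notin> \<int>" using level_not_int q by auto
    then obtain c t where ct: "c + hgt m \<le> hgt n"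
        "\<And>j. j < hgt m \<Longrightarrow> bases (col n) ! (c + j) = bases (col m) ! j + t" "x \<in> level (col n) (c + p)"
      using block_in_later[OF p(2) _ \<open>m \<le> n\<close>] p(1) Suc_lessD by blast
    have "q = c + p" using ct p q by (intro level_col_unique[of x n]) auto
    then show ?thesis using ct(2)[of p] ct(2)[of "Suc p"] p q by simp
  qed
  show ?thesis using *[of y m z n] *[of z n y m] assms nat_le_linear by blast
qed

section \<open>The transformation\<close>

definition X :: "real set" where
  "X = \<Union>(levels col)"

text \<open>Consistency of the column maps makes the choice unique. The identity as default value
  keeps \<open>X\<close> invariant where no column map applies.\<close>

definition T :: "real \<Rightarrow> real" where
  "T x = (if \<exists>n y. (x, y) \<in> column_map (col n) then SOME y. \<exists>n. (x, y) \<in> column_map (col n) else x)"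

lemma T_eq: "(x, y) \<in> column_map (col n) \<Longrightarrow> T x = y"
proof -
  assume *: "(x, y) \<in> column_map (col n)"
  then have "\<exists>n. (x, T x) \<in> column_map (col n)"
    unfolding T_def using someI_ex[of "\<lambda>y. \<exists>n. (x, y) \<in> column_map (col n)"] by auto
  then show "T x = y" using column_map_col_consistent * by blast
qed

lemma T_level:
  "x \<in> level (col m) p \<Longrightarrow> Suc p < hgt m \<Longrightarrow> T x = x + (bases (col m) ! Suc p - bases (col m) ! p)"
  using T_eq column_map_col by blast

lemma funpow_T_level:
  "x \<in> level (col m) p \<Longrightarrow> p + n < hgt m \<Longrightarrow> (T ^^ n) x \<in> level (col m) (p + n)"
proof (induction n)
  case (Suc n)
  then have "(T ^^ n) x \<in> level (col m) (p + n)" by simp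
  moreover from this have "T ((T ^^ n) x) = (T ^^ n) x + (bases (col m) ! Suc (p + n) - bases (col m) ! (p + n))"
    using Suc.prems by (intro T_level) auto
  ultimately show ?case by (auto simp: level_def)
qed simp

lemma in_X_iff: "x \<in> X \<longleftrightarrow> (\<exists>m p. p < hgt m \<and> x \<in> level (col m) p)"
  by (auto simp: X_def levels_def)

lemma level_subset_X: "p < hgt m \<Longrightarrow> level (col m) p \<subseteq> X"
  using in_X_iff by blast

lemma in_X_reach:
  assumes "x \<in> X"
  shows "0 < x" "\<exists>m. x < reach m"
proof -
  obtain m i where "i < hgt m" "x \<in> cell m i" using assms unfolding X_def levels_col by blast
  then have "x \<in> {0<..<reach m}" using cell_subset_reach by blast
  then show "0 < x" "\<exists>m. x < reach m" by auto
qed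

lemma open_X: "open X"
  by (auto simp: X_def levels_col cell_def)

lemma X_borel: "X \<in> sets borel"
  using open_X by simp

lemma T_in_X: "T \<in> X \<rightarrow> X"
proof
  fix x assume x: "x \<in> X"
  show "T x \<in> X"
  proof (cases "\<exists>n y. (x, y) \<in> column_map (col n)")
    case True
    then obtain n y p where "(x, y) \<in> column_map (col n)" "Suc p < hgt n" "x \<in> level (col n) p"
      using column_map_col by blast
    then show ?thesis using funpow_T_level[of x n p 1] level_subset_X by auto
  next
    case False
    then show ?thesis using x unfolding T_def by simp
  qed
qed

text \<open>At least \<open>hgt m\<close> spacers lie above each subcolumn, so off the cut points no
  point stays in top levels forever. Hence \<open>T\<close> is given by column maps on all of
  \<open>X - cut_points\<close>.\<close>

lemma next_level:
  assumes "x \<in> level (col m) p" "p < hgt m" "x \<notin> cut_points"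
  obtains q where "q + hgt m < hgt (Suc m)" "x \<in> level (col (Suc m)) q"
proof -
  obtain k where k: "k < cuts m" "x \<in> level (col (Suc m)) (start m k + p)"
    using level_refine[OF assms(1,2)] not_cut_point[OF assms(3)] by blast
  show ?thesis
    by (rule that[of "start m k + p"]) (use k start_add_hgt[OF k(1)] assms(2) in auto)
qed

lemma T_image:
  assumes Z: "Z \<in> sets borel" "Z \<subseteq> X"
  shows "T ` Z \<in> sets borel" "T ` Z \<subseteq> X" "emeasure lborel (T ` Z) \<le> emeasure lborel Z"
proof -
  \<comment> \<open>The pieces are all levels of all columns except the top ones, enumerated through
    pairs of column and level number.\<close>
  define P where "P i = (case prod_decode i of (m, p) \<Rightarrow> if Suc p < hgt m then level (col m) p else {})" for i
  define c where "c i = (case prod_decode i of (m, p) \<Rightarrow> bases (col m) ! Suc p - bases (col m) ! p)" for i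
  have Tc: "T x = x + c i" if "x \<in> P i" for i x
    using that T_level unfolding P_def c_def by (auto split: prod.splits if_splits)
  have Pb: "P i \<in> sets borel" for i
    unfolding P_def level_def by (auto split: prod.splits)
  have cover: "Z \<subseteq> cut_points \<union> (\<Union>i. P i)"
  proof
    fix x assume "x \<in> Z"
    show "x \<in> cut_points \<union> (\<Union>i. P i)"
    proof (cases "x \<in> cut_points")
      case False
      obtain m p where "p < hgt m" "x \<in> level (col m) p" using \<open>x \<in> Z\<close> Z in_X_iff by blast
      then obtain q where "q + hgt m < hgt (Suc m)" "x \<in> level (col (Suc m)) q"
        using next_level False by blast
      moreover from this have "Suc q < hgt (Suc m)" using hgt_pos[of m] by linarith
      ultimately have "x \<in> P (prod_encode (Suc m, q))" by (simp add: P_def)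
      then show ?thesis by blast
    qed simp
  qed
  show "T ` Z \<in> sets borel" "emeasure lborel (T ` Z) \<le> emeasure lborel Z"
    using piecewise_translation_image[OF countable_cut_points Pb Tc Z(1) cover] by auto
  show "T ` Z \<subseteq> X" using T_in_X Z(2) by blast
qed

lemma funpow_T_image:
  assumes Z: "Z \<in> sets borel" "Z \<subseteq> X"
  shows "(T ^^ n) ` Z \<in> sets borel \<and> (T ^^ n) ` Z \<subseteq> X \<and> emeasure lborel ((T ^^ n) ` Z) \<le> emeasure lborel Z"
proof (induction n)
  case (Suc n)
  have "(T ^^ Suc n) ` Z = T ` ((T ^^ n) ` Z)" by (auto simp: image_image)
  then show ?case using Suc T_image[of "(T ^^ n) ` Z"] by (metis order_trans)
qed (use Z in simp)

lemma funpow_T_image_fmeasurable: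
  assumes "Z \<in> fmeasurable lborel" "Z \<subseteq> X"
  shows "(T ^^ n) ` Z \<in> fmeasurable lborel" "measure lborel ((T ^^ n) ` Z) \<le> measure lborel Z"
proof -
  have *: "(T ^^ n) ` Z \<in> sets borel" "emeasure lborel ((T ^^ n) ` Z) \<le> emeasure lborel Z"
    using funpow_T_image[of Z n] assms by (auto simp: fmeasurable_def)
  have fin: "emeasure lborel Z < \<infinity>" using assms by (auto simp: fmeasurable_def)
  then show "(T ^^ n) ` Z \<in> fmeasurable lborel" using * by (auto simp: fmeasurable_def)
  show "measure lborel ((T ^^ n) ` Z) \<le> measure lborel Z"
    unfolding measure_def using * fin by (intro enn2real_mono) auto
qed

section \<open>Return times\<close>

text \<open>Both points are followed into one tall column. There they lie in copies of
  \<open>col N\<close> starting at multiples of \<open>hgt N\<close>, at positions that differ by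
  exactly \<open>k\<close>.\<close>

lemma return_time_mod:
  assumes x: "x \<in> level (col N) i" "i < hgt N" "x \<notin> cut_points"
    and y: "(T ^^ k) x \<in> level (col N) j" "j < hgt N" "(T ^^ k) x \<notin> cut_points"
  shows "int (hgt N) dvd int i + int k - int j"
proof -
  \<comment> \<open>Since \<open>k \<le> hgt M\<close>, the spacers above any subcolumn of
    \<open>col M\<close> leave room for \<open>k\<close> steps upwards.\<close>
  define M where "M = max N k"
  have M: "N \<le> M" "k \<le> hgt M" using less_hgt[of M] by (auto simp: M_def)
  obtain c where c: "hgt N dvd c" "c + hgt N \<le> hgt M" "x \<in> level (col M) (c + i)"
    using block_in_later[OF x(1,2) M(1) not_cut_point[OF x(3)]] by blast
  have "c + i < hgt M" using c(2) x(2) by simp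
  then obtain a where a: "a < cuts M" "x \<in> level (col (Suc M)) (start M a + (c + i))"
    using level_refine[OF c(3)] not_cut_point[OF x(3)] by blast
  have less: "start M a + (c + i) + k < hgt (Suc M)"
    using start_add_hgt[OF a(1)] c(2) x(2) M(2) by linarith
  then have y1: "(T ^^ k) x \<in> level (col (Suc M)) (start M a + (c + i) + k)"
    using funpow_T_level a(2) by blast
  obtain d where d: "hgt N dvd d" "d + hgt N \<le> hgt (Suc M)" "(T ^^ k) x \<in> level (col (Suc M)) (d + j)"
    using block_in_later[OF y(1,2) le_SucI[OF M(1)] not_cut_point[OF y(3)]] by blast
  have "start M a + (c + i) + k = d + j"
    using level_col_unique[OF y1 d(3) less] d(2) y(2) by linarith
  then have "int i + int k - int j = int d - int c - int (start M a)" by linarith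
  moreover have "hgt N dvd start M a" using hgt_dvd_mono[OF M(1)] by (auto simp: start_def)
  ultimately show ?thesis using c(1) d(1) by (simp add: int_dvd_int_iff)
qed

definition subcolumn :: "nat \<Rightarrow> nat \<Rightarrow> real set" where
  "subcolumn m k = (\<Union>p<hgt m. level (col (Suc m)) (start m k + p))"

text \<open>For \<open>n < hgt (Suc m)\<close> and off cut points, an arithmetical superset of the
  subcolumns of \<open>col m\<close> from which a point can be back in \<open>col m\<close> after
  \<open>n\<close> steps; \<open>k\<close> and \<open>l\<close> are not bounded by
  \<open>cuts m\<close>.\<close>

definition return_starts :: "nat \<Rightarrow> nat \<Rightarrow> nat set" where
  "return_starts m n = {k. \<exists>l p q. p < hgt m \<and> q < hgt m \<and> start m k + p + n = start m l + q}"

text \<open>Positions are compared in \<open>col (Suc (Suc m))\<close>, because \<open>n\<close>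
  steps may lead beyond the top of \<open>col (Suc m)\<close>.\<close>

lemma return_subcolumn:
  assumes x: "x \<in> level (col m) p" "p < hgt m" "x \<notin> cut_points"
    and y: "(T ^^ n) x \<in> level (col m) q" "q < hgt m" "(T ^^ n) x \<notin> cut_points"
    and n: "n < hgt (Suc m)"
  obtains k where "k < cuts m" "x \<in> subcolumn m k" "k \<in> return_starts m n"
proof -
  obtain k where k: "k < cuts m" "x \<in> level (col (Suc m)) (start m k + p)"
    using level_refine[OF x(1,2)] not_cut_point[OF x(3)] by blast
  have kp: "start m k + p < hgt (Suc m)" using start_add_hgt[OF k(1)] x(2) by simp
  obtain k' where k': "k' < cuts (Suc m)" "x \<in> level (col (Suc (Suc m))) (start (Suc m) k' + (start m k + p))"
    using level_refine[OF k(2) kp] not_cut_point[OF x(3)] by blast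
  have less: "start (Suc m) k' + (start m k + p) + n < hgt (Suc (Suc m))"
    using start_add_hgt[OF k'(1)] kp n by linarith
  have y1: "(T ^^ n) x \<in> level (col (Suc (Suc m))) (start (Suc m) k' + (start m k + p) + n)"
    using funpow_T_level[OF k'(2) less] .
  obtain l where l: "l < cuts m" "(T ^^ n) x \<in> level (col (Suc m)) (start m l + q)"
    using level_refine[OF y(1,2)] not_cut_point[OF y(3)] by blast
  have lq: "start m l + q < hgt (Suc m)" using start_add_hgt[OF l(1)] y(2) by simp
  obtain l' where l': "l' < cuts (Suc m)"
      "(T ^^ n) x \<in> level (col (Suc (Suc m))) (start (Suc m) l' + (start m l + q))"
    using level_refine[OF l(2) lq] not_cut_point[OF y(3)] by blast
  have eq: "start (Suc m) k' + (start m k + p) + n = start (Suc m) l' + (start m l + q)"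
    using level_col_unique[OF y1 l'(2) less] start_add_hgt[OF l'(1)] lq by linarith
  \<comment> \<open>Distinct subcolumns of \<open>col (Suc m)\<close> start at least
    \<open>2 * hgt (Suc m)\<close> apart, whereas \<open>n\<close> and both inner positions are
    below \<open>hgt (Suc m)\<close>.\<close>
  have "k' = l'"
    using start_gap[of k' l' "Suc m"] start_gap[of l' k' "Suc m"] eq kp lq n by (cases k' l' rule: linorder_cases) linarith+
  then have "start m k + p + n = start m l + q" using eq by simp
  then have "k \<in> return_starts m n" using x(2) y(2) unfolding return_starts_def by blast
  moreover have "x \<in> subcolumn m k" using k(2) x(2) by (auto simp: subcolumn_def)
  ultimately show ?thesis using that k(1) by blast
qed

text \<open>For a return, \<open>hgt m * (3 ^ l - 3 ^ k)\<close> differs from \<open>n\<close> by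
  less than \<open>hgt m\<close>, so \<open>3 ^ l - 3 ^ k\<close> is \<open>t\<close> or
  \<open>t + 1\<close> with \<open>t = n div hgt m\<close>. Both values are positive because
  \<open>hgt m \<le> n\<close>, and each determines \<open>k\<close>.\<close>

lemma return_starts_subset:
  assumes n: "hgt m \<le> n"
  obtains a b where "return_starts m n \<subseteq> {a, b}"
proof -
  define t where "t = int n div int (hgt m)"
  define S where "S v = {k. \<exists>l. (3::int) ^ l - 3 ^ k = v}" for v
  have t1: "1 \<le> t" using n pos_imp_zdiv_pos_iff[of "int (hgt m)" "int n"] by (simp add: t_def)
  have single: "\<exists>a. S v \<subseteq> {a}" if "0 < v" for v
  proof (cases "S v = {}")
    case False
    then obtain a where "a \<in> S v" by blast
    then have "S v \<subseteq> {a}" using three_power_diff_inject that unfolding S_def by fastforce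
    then show ?thesis by blast
  qed simp
  have "return_starts m n \<subseteq> S t \<union> S (t + 1)"
  proof
    fix k assume "k \<in> return_starts m n"
    then obtain l p q where *: "p < hgt m" "q < hgt m" "start m k + p + n = start m l + q"
      by (auto simp: return_starts_def)
    define D where "D = (3::int) ^ l - 3 ^ k"
    define h where "h = int (hgt m)"
    have st: "int (start m j) = h * 3 ^ j - h" for j
      by (simp add: start_def h_def of_nat_diff right_diff_distrib)
    have "h * D = int n + int p - int q"
      using arg_cong[OF *(3), of int] by (simp add: st D_def right_diff_distrib)
    moreover have "int n = h * t + int n mod h" "0 \<le> int n mod h" "int n mod h < h"
      using hgt_pos[of m] by (simp_all add: t_def h_def del: hgt_pos)
    ultimately have "h * D < h * t + 2 * h" "h * t - h < h * D"
      using * unfolding h_def by linarith+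
    then have "h * D < h * (t + 2)" "h * (t - 1) < h * D" by (simp_all add: algebra_simps)
    moreover have "0 < h" by (simp add: h_def)
    ultimately have "D < t + 2" "t - 1 < D" by (simp_all only: mult_less_cancel_left_pos)
    then have "D = t \<or> D = t + 1" by linarith
    then show "k \<in> S t \<union> S (t + 1)" unfolding S_def D_def by blast
  qed
  moreover obtain a where "S t \<subseteq> {a}" using single[of t] t1 by auto
  moreover obtain b where "S (t + 1) \<subseteq> {b}" using single[of "t + 1"] t1 by auto
  ultimately show ?thesis using that[of a b] by blast
qed

section \<open>Measure of returns and zero type\<close>

lemma cell_fmeasurable: "cell m i \<in> fmeasurable lborel"
  and measure_cell: "measure lborel (cell m i) = 1 / den m"
  by (simp_all add: cell_def fmeasurable_def divide_right_mono diff_divide_distrib[symmetric])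

lemma level_fmeasurable: "p < hgt m \<Longrightarrow> level (col m) p \<in> fmeasurable lborel"
  and measure_level: "p < hgt m \<Longrightarrow> measure lborel (level (col m) p) = 1 / den m"
  by (simp_all add: level_col cell_fmeasurable measure_cell)

lemma subcolumn:
  assumes "k < cuts m"
  shows "subcolumn m k \<in> fmeasurable lborel" "subcolumn m k \<subseteq> X"
    "measure lborel (subcolumn m k) \<le> 1 / Suc m"
proof -
  have less: "start m k + p < hgt (Suc m)" if "p < hgt m" for p
    using start_add_hgt[OF assms] that by simp
  show "subcolumn m k \<in> fmeasurable lborel"
    unfolding subcolumn_def using less by (intro fmeasurable.finite_UN level_fmeasurable) auto
  show "subcolumn m k \<subseteq> X" unfolding subcolumn_def using less level_subset_X by blast
  have "measure lborel (subcolumn m k) \<le> (\<Sum>p<hgt m. measure lborel (level (col (Suc m)) (start m k + p)))"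
    unfolding subcolumn_def
    by (rule measure_UNION_le) (use less level_fmeasurable in \<open>auto simp: fmeasurable_def\<close>)
  also have "\<dots> = hgt m / den (Suc m)" using less by (simp add: measure_level)
  also have "\<dots> \<le> 1 / Suc m"
  proof -
    \<comment> \<open>The factor \<open>hgt m\<close> in \<open>cuts m\<close> cancels the number of
      levels in the subcolumn; the factor \<open>m + 2\<close> supplies the decay.\<close>
    have "hgt m * Suc m \<le> den m * cuts m"
      unfolding cuts_def using mult_le_mono[of 1 "den m" "hgt m * Suc m" "(m + 2) * hgt m"]
      by (simp add: Suc_le_eq)
    then have "real (hgt m * Suc m) \<le> real (den (Suc m))" unfolding den_Suc by (rule of_nat_mono)
    then show ?thesis by (simp add: field_simps)
  qed
  finally show "measure lborel (subcolumn m k) \<le> 1 / Suc m" .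
qed

lemma countable_null: "countable (N :: real set) \<Longrightarrow> N \<in> fmeasurable lborel \<and> measure lborel N = 0"
  using emeasure_lborel_countable[of N] sets.countable[of N borel] by (auto simp: fmeasurable_def measure_def)

text \<open>Off a null set, a return from \<open>x\<close> to \<open>y\<close> has \<open>x\<close>
  or \<open>y\<close> beyond \<open>reach m\<close>, or \<open>x\<close> in one of at most two thin
  subcolumns. Forward images do not increase measure, so the four contributions add up.\<close>

lemma measure_return_le:
  assumes A: "A \<in> fmeasurable lborel" "A \<subseteq> X" and n: "hgt m \<le> n" "n < hgt (Suc m)"
  shows "measure lborel (A \<inter> (T ^^ n) ` A) \<le> 2 * measure lborel (A - {..<reach m}) + 2 / Suc m"
proof -
  let ?\<mu> = "measure lborel" and ?F = "fmeasurable lborel :: real set set"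
  define B where "B = A - {..<reach m}"
  have B: "B \<in> ?F" "B \<subseteq> X" using A by (auto simp: B_def intro: fmeasurable_Diff)
  obtain a b where ab: "return_starts m n \<subseteq> {a, b}" using return_starts_subset n by blast
  \<comment> \<open>The candidates \<open>a\<close> and \<open>b\<close> need not be numbers of
    subcolumns; they then contribute the empty set.\<close>
  define U where "U k = (if k < cuts m then subcolumn m k else {})" for k
  have U: "U k \<in> ?F" "U k \<subseteq> X" "?\<mu> (U k) \<le> 1 / Suc m" for k
    using subcolumn[of k m] by (auto simp: U_def)
  define N where "N = cut_points \<union> (T ^^ n) ` cut_points"
  have N: "N \<in> ?F" "?\<mu> N = 0"
    using countable_null[of N] countable_cut_points by (auto simp: N_def)
  have sub: "A \<inter> (T ^^ n) ` A \<subseteq> N \<union> (B \<union> ((T ^^ n) ` B \<union> ((T ^^ n) ` U a \<union> (T ^^ n) ` U b)))"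
  proof
    fix y assume "y \<in> A \<inter> (T ^^ n) ` A"
    then obtain x where x: "x \<in> A" "y = (T ^^ n) x" "y \<in> A" by blast
    show "y \<in> N \<union> (B \<union> ((T ^^ n) ` B \<union> ((T ^^ n) ` U a \<union> (T ^^ n) ` U b)))"
    proof (cases "x \<in> cut_points \<or> y \<in> cut_points \<or> x \<in> B \<or> y \<in> B")
      case True
      then show ?thesis using x by (auto simp: N_def)
    next
      case False
      have pos: "0 < z" if "z \<in> A" for z
        using that A(2) in_X_reach(1) by blast
      have "x < reach m" "y < reach m" using False x by (auto simp: B_def)
      then obtain p q where "p < hgt m" "x \<in> level (col m) p" "q < hgt m" "y \<in> level (col m) q"
        using in_some_level[of x m] in_some_level[of y m] pos x False not_cut_point by metis
      then obtain k where k: "k < cuts m" "x \<in> subcolumn m k" "k \<in> return_starts m n"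
        using return_subcolumn[of x m p n q] False x n by blast
      then have "x \<in> U k" "k = a \<or> k = b" using ab by (auto simp: U_def)
      then show ?thesis using x by blast
    qed
  qed
  have img: "(T ^^ n) ` Z \<in> ?F" "?\<mu> ((T ^^ n) ` Z) \<le> ?\<mu> Z" if "Z \<in> ?F" "Z \<subseteq> X" for Z
    using funpow_T_image_fmeasurable that by auto
  have un: "?\<mu> (P \<union> Q) \<le> ?\<mu> P + ?\<mu> Q" if "P \<in> ?F" "Q \<in> ?F" for P Q
    using measure_Un_le[of P lborel Q] that by (auto simp: fmeasurable_def)
  have TA: "(T ^^ n) ` A \<in> ?F" using img(1) A by blast
  have m1: "(T ^^ n) ` U a \<union> (T ^^ n) ` U b \<in> ?F" using img U by auto
  have m2: "(T ^^ n) ` B \<union> ((T ^^ n) ` U a \<union> (T ^^ n) ` U b) \<in> ?F" using img(1) B m1 by auto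
  have m3: "B \<union> ((T ^^ n) ` B \<union> ((T ^^ n) ` U a \<union> (T ^^ n) ` U b)) \<in> ?F" using B m2 by auto
  have "?\<mu> (A \<inter> (T ^^ n) ` A) \<le> ?\<mu> (N \<union> (B \<union> ((T ^^ n) ` B \<union> ((T ^^ n) ` U a \<union> (T ^^ n) ` U b))))"
    by (rule measure_mono_fmeasurable[OF sub]) (use A TA fmeasurable.Un[OF N(1) m3] in \<open>auto simp: fmeasurable_def\<close>)
  also have "\<dots> \<le> ?\<mu> N + (?\<mu> B + (?\<mu> ((T ^^ n) ` B) + (?\<mu> ((T ^^ n) ` U a) + ?\<mu> ((T ^^ n) ` U b))))"
    using un[OF N(1) m3] un[OF B(1) m2] un[OF img(1)[OF B] m1] un[OF img(1)[OF U(1,2)] img(1)[OF U(1,2)], of a b]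
    by linarith
  also have "\<dots> \<le> 0 + (?\<mu> B + (?\<mu> B + (1 / Suc m + 1 / Suc m)))"
    using img(2)[OF B] img(2)[OF U(1,2), of a] img(2)[OF U(1,2), of b] U(3)[of a] U(3)[of b] N(2) by linarith
  finally show ?thesis by (simp add: B_def)
qed

text \<open>The intervals below \<open>reach m\<close> exhaust \<open>X\<close>, so the part of
  \<open>A\<close> beyond \<open>reach m\<close> shrinks to measure 0, and both terms of the
  previous bound vanish in the limit.\<close>

lemma measure_return_tendsto_0:
  assumes A: "A \<in> fmeasurable lborel" "A \<subseteq> X"
  shows "(\<lambda>n. measure lborel (A \<inter> (T ^^ n) ` A)) \<longlonglongrightarrow> 0"
proof -
  have "(\<lambda>m. measure lborel (A - {..<reach m})) \<longlonglongrightarrow> measure lborel (\<Inter>m. A - {..<reach m})"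
  proof (rule Lim_measure_decseq)
    show "range (\<lambda>m. A - {..<reach m}) \<subseteq> sets lborel" using A by (auto simp: fmeasurable_def)
    show "decseq (\<lambda>m. A - {..<reach m})"
      unfolding decseq_def using reach_mono by (auto intro: order_less_le_trans)
    show "emeasure lborel (A - {..<reach i}) \<noteq> \<infinity>" for i
      using fmeasurable_Diff[OF A(1), of "{..<reach i}"] by (auto simp: fmeasurable_def)
  qed
  also have "(\<Inter>m. A - {..<reach m}) = {}"
  proof -
    have "A \<subseteq> (\<Union>m. {..<reach m})" using A(2) in_X_reach(2) by auto
    then show ?thesis by blast
  qed
  finally have "(\<lambda>m. measure lborel (A - {..<reach m})) \<longlonglongrightarrow> 0" by simp
  moreover have "(\<lambda>m. 1 / real (Suc m)) \<longlonglongrightarrow> 0"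
    using LIMSEQ_inverse_real_of_nat by (simp add: inverse_eq_divide)
  ultimately have "(\<lambda>m. 2 * measure lborel (A - {..<reach m}) + 2 * (1 / Suc m)) \<longlonglongrightarrow> 2 * 0 + 2 * 0"
    by (intro tendsto_intros)
  then have lim: "(\<lambda>m. 2 * measure lborel (A - {..<reach m}) + 2 / Suc m) \<longlonglongrightarrow> 0" by simp
  show ?thesis
  proof (rule LIMSEQ_I)
    fix e :: real assume "0 < e"
    then have "\<forall>\<^sub>F m in sequentially. 2 * measure lborel (A - {..<reach m}) + 2 / Suc m < e"
      by (rule order_tendstoD(2)[OF lim])
    then obtain m0 where m0: "\<And>m. m0 \<le> m \<Longrightarrow> 2 * measure lborel (A - {..<reach m}) + 2 / Suc m < e"
      unfolding eventually_sequentially by blast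
    show "\<exists>n0. \<forall>n\<ge>n0. norm (measure lborel (A \<inter> (T ^^ n) ` A) - 0) < e"
    proof (intro exI allI impI)
      fix n assume n: "hgt m0 \<le> n"
      \<comment> \<open>The last stage of height at most \<open>n\<close>: it exists because
        \<open>k < hgt k\<close> bounds such stages by \<open>n\<close>, and maximality gives
        \<open>n < hgt (Suc m)\<close>.\<close>
      define m where "m = (GREATEST m. hgt m \<le> n)"
      have bound: "k \<le> n" if "hgt k \<le> n" for k using less_hgt[of k] that by simp
      have "hgt m \<le> n" unfolding m_def by (rule GreatestI_nat[where b = n and P = "\<lambda>m. hgt m \<le> n", OF n bound])
      moreover have le_m: "k \<le> m" if "hgt k \<le> n" for k
        unfolding m_def by (rule Greatest_le_nat[where b = n and P = "\<lambda>m. hgt m \<le> n", OF that bound])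
      then have "n < hgt (Suc m)" using not_less_eq_eq[of m m] by (meson le_refl not_le)
      moreover have "m0 \<le> m" using le_m n by blast
      ultimately show "norm (measure lborel (A \<inter> (T ^^ n) ` A) - 0) < e"
        using measure_return_le[OF A, of m n] m0[of m] by simp
    qed
  qed
qed

section \<open>Failure of rational weak mixing\<close>

text \<open>A level of \<open>col N\<close> has measure \<open>1 / den N\<close>, which eventually
  drops below the measure of the part of \<open>F\<close> below \<open>reach N\<close>. One level
  then cannot carry that part alone.\<close>

lemma two_levels:
  assumes F: "F \<in> fmeasurable lborel" "F \<subseteq> X" "0 < measure lborel F"
  obtains N i j where "i < hgt N" "j < hgt N" "i \<noteq> j"
    "0 < measure lborel (F \<inter> level (col N) i)" "0 < measure lborel (F \<inter> level (col N) j)"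
proof -
  let ?\<mu> = "measure lborel"
  have "(\<lambda>m. ?\<mu> (F \<inter> {..<reach m})) \<longlonglongrightarrow> ?\<mu> (\<Union>m. F \<inter> {..<reach m})"
  proof (rule Lim_measure_incseq)
    show "range (\<lambda>m. F \<inter> {..<reach m}) \<subseteq> sets lborel" using F by (auto simp: fmeasurable_def)
    show "incseq (\<lambda>m. F \<inter> {..<reach m})"
      unfolding incseq_def using reach_mono by (auto intro: order_less_le_trans)
    have "(\<Union>m. F \<inter> {..<reach m}) \<in> fmeasurable lborel"
      by (rule fmeasurableI2[OF F(1)]) (use F in \<open>auto simp: fmeasurable_def\<close>)
    then show "emeasure lborel (\<Union>m. F \<inter> {..<reach m}) \<noteq> \<infinity>" by (auto simp: fmeasurable_def)
  qed
  also have "(\<Union>m. F \<inter> {..<reach m}) = F"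
  proof -
    have "F \<subseteq> (\<Union>m. {..<reach m})" using F(2) in_X_reach(2) by auto
    then show ?thesis by blast
  qed
  finally have lim: "(\<lambda>m. ?\<mu> (F \<inter> {..<reach m})) \<longlonglongrightarrow> ?\<mu> F" .
  have "(\<lambda>m. 1 / real (den m)) \<longlonglongrightarrow> 0"
  proof (rule tendsto_sandwich[OF _ _ tendsto_const])
    show "(\<lambda>m. 1 / real (Suc m)) \<longlonglongrightarrow> 0"
      using LIMSEQ_inverse_real_of_nat by (simp add: inverse_eq_divide)
    show "\<forall>\<^sub>F m in sequentially. 1 / real (den m) \<le> 1 / real (Suc m)"
    proof (intro always_eventually allI)
      fix m
      have "real (Suc m) \<le> real (den m)" using less_den[of m] by (intro of_nat_mono) simp
      then show "1 / real (den m) \<le> 1 / real (Suc m)" by (intro divide_left_mono) auto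
    qed
  qed simp
  with lim have "(\<lambda>m. ?\<mu> (F \<inter> {..<reach m}) - 1 / den m) \<longlonglongrightarrow> ?\<mu> F - 0" by (rule tendsto_diff)
  then have "\<forall>\<^sub>F m in sequentially. 0 < ?\<mu> (F \<inter> {..<reach m}) - 1 / den m"
    using F(3) by (intro order_tendstoD(1)[of _ "?\<mu> F"]) auto
  then obtain N where N: "1 / den N < ?\<mu> (F \<inter> {..<reach N})"
    by (auto simp: eventually_sequentially)
  define f where "f p = ?\<mu> (F \<inter> level (col N) p)" for p
  have Fl: "F \<inter> level (col N) p \<in> fmeasurable lborel" if "p < hgt N" for p
    using fmeasurable_Int_fmeasurable[OF F(1)] level_fmeasurable[OF that] by (auto simp: fmeasurable_def)
  have f_le: "f p \<le> 1 / den N" if "p < hgt N" for p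
    unfolding f_def measure_level[OF that, symmetric]
    using Fl[OF that] level_fmeasurable[OF that] by (intro measure_mono_fmeasurable) auto
  have sum: "1 / den N < (\<Sum>p<hgt N. f p)"
  proof -
    note N
    also have "?\<mu> (F \<inter> {..<reach N}) \<le> ?\<mu> (cut_points \<union> (\<Union>p<hgt N. F \<inter> level (col N) p))"
    proof (rule measure_mono_fmeasurable)
      show "F \<inter> {..<reach N} \<subseteq> cut_points \<union> (\<Union>p<hgt N. F \<inter> level (col N) p)"
      proof
        fix x assume x: "x \<in> F \<inter> {..<reach N}"
        then have "0 < x" using F(2) in_X_reach(1) by blast
        then show "x \<in> cut_points \<union> (\<Union>p<hgt N. F \<inter> level (col N) p)"
          using x in_some_level[of x N] not_cut_point[of x N] by auto
      qed
      show "cut_points \<union> (\<Union>p<hgt N. F \<inter> level (col N) p) \<in> fmeasurable lborel"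
        using countable_null[OF countable_cut_points] Fl
        by (intro fmeasurable.Un fmeasurable.finite_UN) auto
    qed (use F in \<open>auto simp: fmeasurable_def\<close>)
    also have "\<dots> \<le> ?\<mu> cut_points + ?\<mu> (\<Union>p<hgt N. F \<inter> level (col N) p)"
      using countable_null[OF countable_cut_points] Fl
      by (intro measure_Un_le) (auto simp: fmeasurable_def simp del: UN_simps)
    also have "\<dots> \<le> 0 + (\<Sum>p<hgt N. f p)"
      using countable_null[OF countable_cut_points] unfolding f_def
      by (intro add_mono measure_UNION_le) (use Fl in \<open>auto simp: fmeasurable_def\<close>)
    finally show ?thesis by simp
  qed
  have nn: "0 \<le> f p" for p by (simp add: f_def)
  have "0 < (\<Sum>p<hgt N. f p)" using sum by (meson divide_nonneg_nonneg le_less_trans of_nat_0_le_iff zero_le_one)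
  then obtain i where i: "i < hgt N" "0 < f i"
    using sum_nonpos[of "{..<hgt N}" f] by (meson lessThan_iff not_less)
  have "(\<Sum>p<hgt N. f p) = f i + (\<Sum>p\<in>{..<hgt N} - {i}. f p)" using i by (intro sum.remove) auto
  then have "0 < (\<Sum>p\<in>{..<hgt N} - {i}. f p)" using sum f_le[OF i(1)] by linarith
  then obtain j where j: "j \<in> {..<hgt N} - {i}" "0 < f j"
    using sum_nonpos[of "{..<hgt N} - {i}" f] by (meson not_less)
  show ?thesis using that[of i N j] i j by (auto simp: f_def)
qed

text \<open>By \<open>return_time_mod\<close>, such a passage can only involve a cut point or the
  image of one.\<close>

lemma measure_return_levels_0:
  assumes "A \<subseteq> level (col N) i" "B \<subseteq> level (col N) j" "i < hgt N" "j < hgt N"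
    and "\<not> int (hgt N) dvd int j + int k - int i"
  shows "measure lborel (A \<inter> (T ^^ k) ` B) = 0"
proof -
  have sub: "A \<inter> (T ^^ k) ` B \<subseteq> cut_points \<union> (T ^^ k) ` cut_points"
  proof
    fix y assume "y \<in> A \<inter> (T ^^ k) ` B"
    then obtain x where "x \<in> level (col N) j" "y = (T ^^ k) x" "y \<in> level (col N) i"
      using assms(1,2) by blast
    then show "y \<in> cut_points \<union> (T ^^ k) ` cut_points"
      using return_time_mod[of x N j k i] assms(3-5) by auto
  qed
  have "countable (cut_points \<union> (T ^^ k) ` cut_points)" using countable_cut_points by simp
  then show ?thesis using countable_null[OF countable_subset[OF sub]] by simp
qed

lemma not_rationally_weakly_mixing_T: "\<not> rationally_weakly_mixing (restrict_space lborel X) T"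
proof
  let ?M = "restrict_space lborel X" and ?\<mu> = "measure lborel"
  assume "rationally_weakly_mixing ?M T"
  then obtain F where F: "F \<in> sets ?M" "0 < emeasure ?M F" "emeasure ?M F < \<infinity>"
    and mix: "\<forall>A\<in>sets ?M. \<forall>B\<in>sets ?M. A \<subseteq> F \<longrightarrow> B \<subseteq> F \<longrightarrow>
           (\<lambda>n. 1 / a_seq ?M T F n *
                (\<Sum>k<n. \<bar>measure ?M (A \<inter> (T ^^ k) ` B)
                         - measure ?M A * measure ?M B * u_seq ?M T F k\<bar>)) \<longlonglongrightarrow> 0"
    unfolding rationally_weakly_mixing_def by (elim bexE conjE) (rule that)
  have sets_M: "S \<in> sets ?M \<longleftrightarrow> S \<in> sets borel \<and> S \<subseteq> X" for S
    using sets_restrict_space_iff[of X lborel S] X_borel by auto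
  have meas_M: "measure ?M S = ?\<mu> S" if "S \<subseteq> X" for S
    using measure_restrict_space[of X lborel S] X_borel that by simp
  have emeas_M: "emeasure ?M S = emeasure lborel S" if "S \<subseteq> X" for S
    using emeasure_restrict_space[of X lborel S] X_borel that by simp
  have FX: "F \<in> fmeasurable lborel" "F \<subseteq> X"
    using F sets_M emeas_M by (auto simp: fmeasurable_def)
  moreover have "0 < ?\<mu> F"
    using F(2) emeas_M[OF FX(2)] FX(1) emeasure_eq_measure2[OF FX(1)]
    by (auto simp: fmeasurable_def)
  ultimately obtain N i j where ij: "i < hgt N" "j < hgt N" "i \<noteq> j"
      "0 < ?\<mu> (F \<inter> level (col N) i)" "0 < ?\<mu> (F \<inter> level (col N) j)"
    using two_levels by blast
  define A where "A = F \<inter> level (col N) i"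
  define B where "B = F \<inter> level (col N) j"
  define u where "u = u_seq ?M T F"
  define a where "a = a_seq ?M T F"
  \<comment> \<open>Whichever of the two intersections is null at time \<open>k\<close>, the
    corresponding summand is at least \<open>c * u k\<close>.\<close>
  define c where "c = min (?\<mu> A * ?\<mu> A) (?\<mu> A * ?\<mu> B)"
  have AB: "A \<in> sets ?M" "B \<in> sets ?M" "A \<subseteq> F" "B \<subseteq> F" "A \<subseteq> X" "B \<subseteq> X"
    using F(1) FX(2) by (auto simp: A_def B_def sets_M level_def)
  have c: "0 < c" using ij by (simp add: c_def A_def B_def)
  have u: "0 \<le> u k" for k by (simp add: u_def u_seq_def)
  define f where "f k = \<bar>?\<mu> (A \<inter> (T ^^ k) ` A) - ?\<mu> A * ?\<mu> A * u k\<bar>" for k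
  define g where "g k = \<bar>?\<mu> (A \<inter> (T ^^ k) ` B) - ?\<mu> A * ?\<mu> B * u k\<bar>" for k
  have mA: "measure ?M (A \<inter> S) = ?\<mu> (A \<inter> S)" for S using AB(5) by (intro meas_M) auto
  have "(\<lambda>n. 1 / a n * (\<Sum>k<n. f k)) \<longlonglongrightarrow> 0"
    using mix[rule_format, OF AB(1,1,3,3)] by (simp only: meas_M[OF AB(5)] mA f_def a_def u_def)
  moreover have "(\<lambda>n. 1 / a n * (\<Sum>k<n. g k)) \<longlonglongrightarrow> 0"
    using mix[rule_format, OF AB(1,2,3,4)]
    by (simp only: meas_M[OF AB(5)] meas_M[OF AB(6)] mA g_def a_def u_def)
  ultimately have lim: "(\<lambda>n. 1 / a n * (\<Sum>k<n. f k) + 1 / a n * (\<Sum>k<n. g k)) \<longlonglongrightarrow> 0 + 0"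
    by (rule tendsto_add)
  have fg: "c * u k \<le> f k + g k" for k
  \<comment> \<open>Times divisible by \<open>hgt N\<close> exclude passages from level
    \<open>j\<close> to level \<open>i\<close>, as the distance of \<open>i\<close> and
    \<open>j\<close> is positive and below \<open>hgt N\<close>; all other times exclude returns
    from level \<open>i\<close> to itself.\<close>
  proof (cases "int (hgt N) dvd int k")
    case True
    have "\<not> int (hgt N) dvd int j - int i"
    proof
      assume "int (hgt N) dvd int j - int i"
      then have "\<bar>int (hgt N)\<bar> \<le> \<bar>int j - int i\<bar>" using ij by (intro dvd_imp_le_int) auto
      then show False using ij by linarith
    qed
    moreover have "int j + int k - int i = (int j - int i) + int k" by simp
    ultimately have "\<not> int (hgt N) dvd int j + int k - int i"
      using dvd_add_left_iff[OF True, of "int j - int i"] by (simp only: not_False_eq_True)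
    then have "?\<mu> (A \<inter> (T ^^ k) ` B) = 0"
      using ij by (intro measure_return_levels_0[of A N i B j]) (auto simp: A_def B_def)
    then have "g k = ?\<mu> A * ?\<mu> B * u k" using u[of k] by (simp add: g_def abs_mult)
    moreover have "c * u k \<le> ?\<mu> A * ?\<mu> B * u k"
      using u by (intro mult_right_mono) (auto simp: c_def)
    ultimately show ?thesis by (simp add: f_def)
  next
    case False
    then have "?\<mu> (A \<inter> (T ^^ k) ` A) = 0"
      using ij by (intro measure_return_levels_0[of A N i A i]) (auto simp: A_def)
    then have "f k = ?\<mu> A * ?\<mu> A * u k" using u[of k] by (simp add: f_def abs_mult)
    moreover have "c * u k \<le> ?\<mu> A * ?\<mu> A * u k"
      using u by (intro mult_right_mono) (auto simp: c_def)
    ultimately show ?thesis by (simp add: g_def)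
  qed
  have "c \<le> 1 / a n * (\<Sum>k<n. f k) + 1 / a n * (\<Sum>k<n. g k)" if "1 \<le> n" for n
  proof -
    have a: "a n = (\<Sum>k<n. u k)" by (simp add: a_def u_def a_seq_def)
    \<comment> \<open>The term at time 0 is \<open>1 / measure lborel F\<close>, so
      \<open>a n\<close> is positive from \<open>n = 1\<close> on; at \<open>n = 0\<close> the
      quotients are 0 and the bound would fail.\<close>
    have "0 < u 0" using \<open>0 < ?\<mu> F\<close> FX by (simp add: u_def u_seq_def meas_M)
    also have "u 0 \<le> a n" unfolding a using that u by (intro member_le_sum) auto
    finally have "0 < a n" .
    have "c * a n \<le> (\<Sum>k<n. f k) + (\<Sum>k<n. g k)"
      unfolding a sum_distrib_left sum.distrib[symmetric] by (intro sum_mono fg)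
    then show ?thesis using \<open>0 < a n\<close> by (simp add: add_divide_distrib[symmetric] pos_le_divide_eq)
  qed
  then have "c \<le> 0 + 0" by (intro LIMSEQ_le_const[OF lim]) auto
  then show False using c by simp
qed

lemma zero_type_T: "zero_type (restrict_space lborel X) T"
  unfolding zero_type_def
proof (intro ballI impI)
  fix A assume A: "A \<in> sets (restrict_space lborel X)" "emeasure (restrict_space lborel X) A < \<infinity>"
  then have AX: "A \<subseteq> X" "A \<in> sets borel"
    using sets_restrict_space_iff[of X lborel A] X_borel by auto
  have "emeasure lborel A < \<infinity>" using A(2) AX X_borel by (simp add: emeasure_restrict_space)
  then have "(\<lambda>n. measure lborel (A \<inter> (T ^^ n) ` A)) \<longlonglongrightarrow> 0"
    using measure_return_tendsto_0[of A] AX by (simp add: fmeasurable_def)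
  moreover have "measure (restrict_space lborel X) (A \<inter> (T ^^ n) ` A) = measure lborel (A \<inter> (T ^^ n) ` A)" for n
    using AX X_borel by (intro measure_restrict_space) auto
  ultimately show "(\<lambda>n. measure (restrict_space lborel X) (A \<inter> (T ^^ n) ` A)) \<longlonglongrightarrow> 0" by simp
qed

section \<open>The levels generate\<close>

lemma cell_div:
  assumes "den n = den m * q" "x \<in> cell n l"
  shows "x \<in> cell m (l div q)"
proof -
  have q: "0 < q" using den_pos[of n] assms(1) by (metis mult_is_0 neq0_conv)
  have x: "real l < x * den m * q" "x * den m * q < real l + 1"
    using assms by (simp_all add: in_cell_iff mult.assoc)
  have "l div q * q \<le> l" by simp
  then have "real (l div q * q) \<le> real l" by (rule of_nat_mono)
  then have "real (l div q) * q < x * den m * q" using x by simp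
  moreover have "l + 1 \<le> (l div q + 1) * q"
    using q dividend_less_div_times[of q l] by simp
  then have "real (l + 1) \<le> real ((l div q + 1) * q)" by (rule of_nat_mono)
  then have "x * den m * q < (real (l div q) + 1) * q" using x by (simp add: distrib_right)
  ultimately show ?thesis using q by (simp add: in_cell_iff)
qed

lemma cells_nested:
  assumes "m \<le> n"
  shows "cell n l \<subseteq> cell m i \<or> cell n l \<inter> cell m i = {}"
proof -
  obtain q where q: "den n = den m * q" using den_dvd_mono[OF assms] by blast
  show ?thesis using cell_div[OF q] cell_unique by blast
qed

lemma cell_refine:
  assumes q: "den n = den m * q" and "x \<in> cell m i" "x * den n \<notin> \<int>"
  obtains l where "x \<in> cell n l" "l div q = i"
proof -
  have "0 < x"
    using assms(2) den_pos[of m] by (auto simp: in_cell_iff simp del: den_pos)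
      (metis le_less_trans of_nat_0_le_iff of_nat_0_less_iff zero_less_mult_pos2)
  then obtain l where "x \<in> cell n l" using in_some_cell assms(3) by blast
  then show ?thesis using that cell_div[OF q] cell_unique assms(2) by blast
qed

text \<open>The levels without endpoints of levels, in a form convenient for computing with grids:
  inside \<open>X\<close> those endpoints are exactly the cut points.\<close>

definition pure_cells :: "real set set" where
  "pure_cells = {cell m i - cut_points | m i. i < hgt m}"

text \<open>A grid point of \<open>X\<close> remains a grid point at finer scales and eventually
  lies below \<open>reach M\<close>. As \<open>col M\<close> has no gaps there, the point is the
  left endpoint of a level.\<close>

lemma X_diff_endpoints: "X - endpoints col = X - cut_points"
proof -
  have sub: "endpoints col \<subseteq> cut_points"
  proof
    fix x assume "x \<in> endpoints col"
    then obtain n i where "x = real i / den n \<or> x = real i / den n + 1 / den n"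
      by (auto simp: endpoints_def col_def)
    then have "x * den n = of_nat i \<or> x * den n = of_nat (Suc i)"
      using den_pos[of n] by (auto simp: field_simps simp del: den_pos)
    then have "x * den n \<in> \<int>" by (metis Ints_of_nat)
    then show "x \<in> cut_points" by (auto simp: cut_points_def)
  qed
  have "x \<in> endpoints col" if x: "x \<in> X" "x \<in> cut_points" for x
  proof -
    obtain m where m: "0 < x" "x < reach m" using x in_X_reach[of x] by auto
    obtain n where n: "x * den n \<in> \<int>" using x by (auto simp: cut_points_def)
    define M where "M = max m n"
    have "x * den M \<in> \<int>" using den_int_mono[of n M] n by (simp add: M_def)
    moreover have "0 \<le> x * den M" using m by simp
    ultimately obtain i where i: "x * den M = real i"
      by (metis Ints_cases nonneg_int_cases of_int_0_le_iff of_int_of_nat_eq)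
    have "x < reach M" using m reach_mono[of m M] by (simp add: M_def)
    then have "x * den M < hgt M" using den_pos[of M] by (simp add: reach_def field_simps del: den_pos)
    then have "i < hgt M" using i by simp
    moreover have "x = real i / den M" using i den_pos[of M] by (simp add: field_simps del: den_pos)
    ultimately have "x \<in> set (bases (col M))" by (auto simp: col_def set_level_index)
    then show ?thesis by (auto simp: endpoints_def)
  qed
  with sub show ?thesis by blast
qed

lemma levels_diff_endpoints: "(\<lambda>I. I - endpoints col) ` levels col = pure_cells"
proof -
  have "I - endpoints col = I - cut_points" if "I \<in> levels col" for I
    using X_diff_endpoints that unfolding X_def by blast
  then show ?thesis unfolding pure_cells_def levels_col by (auto simp: image_iff)
qed

lemma pure_cells_subset: "S \<in> pure_cells \<Longrightarrow> S \<subseteq> X - cut_points"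
  unfolding X_def levels_col pure_cells_def by blast

lemma semiring_pure_cells: "semiring_of_sets (X - cut_points) (insert {} pure_cells)"
proof
  show "insert {} pure_cells \<subseteq> Pow (X - cut_points)" using pure_cells_subset by blast
  show "{} \<in> insert {} pure_cells" by simp
  have nested: "a \<subseteq> b \<or> b \<subseteq> a \<or> a \<inter> b = {}" if ab: "a \<in> pure_cells" "b \<in> pure_cells" for a b
  proof -
    obtain m i where a: "a = cell m i - cut_points" using ab by (auto simp: pure_cells_def)
    obtain n j where b: "b = cell n j - cut_points" using ab by (auto simp: pure_cells_def)
    show ?thesis unfolding a b using cells_nested[of m n j i] cells_nested[of n m i j] nat_le_linear[of m n] by blast
  qed
  fix a b assume ab: "a \<in> insert {} pure_cells" "b \<in> insert {} pure_cells"
  show "a \<inter> b \<in> insert {} pure_cells" using ab nested[of a b] by (auto simp: Int_absorb1 Int_absorb2)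
  show "\<exists>C\<subseteq>insert {} pure_cells. finite C \<and> disjoint C \<and> a - b = \<Union>C"
  proof (cases "a = {} \<or> b = {} \<or> a \<subseteq> b \<or> a \<inter> b = {}")
    case True
    then have "a - b = {} \<or> a - b = a" by blast
    then show ?thesis
    proof
      assume "a - b = {}"
      then show ?thesis by (intro exI[of _ "{}"]) (auto simp: disjoint_def)
    next
      assume "a - b = a"
      then show ?thesis using ab by (intro exI[of _ "{a}"]) (auto simp: disjoint_def)
    qed
  next
    case False
    then obtain m i where a: "a = cell m i - cut_points" "i < hgt m" using ab by (auto simp: pure_cells_def)
    obtain n j where b: "b = cell n j - cut_points" "j < hgt n" using False ab by (auto simp: pure_cells_def)
    \<comment> \<open>If \<open>a\<close> had the finer scale, it would be contained in
      \<open>b\<close> or disjoint from it, which are the cases already settled.\<close>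
    have "m \<le> n" using cells_nested[of n m i j] False unfolding a b by (cases "m \<le> n") auto
    obtain q where q: "den n = den m * q" using den_dvd_mono[OF \<open>m \<le> n\<close>] by blast
    have q0: "0 < q" using den_pos[of n] q by (metis mult_is_0 neq0_conv)
    \<comment> \<open>The interval filled by \<open>col n\<close> contains the one filled by
      \<open>col m\<close>, so the fine cells inside \<open>a\<close> are levels of
      \<open>col n\<close>.\<close>
    have "real (hgt m) * q \<le> hgt n"
      using reach_mono[OF \<open>m \<le> n\<close>] den_pos[of m] q0 by (simp add: reach_def q field_simps del: den_pos)
    then have "real (hgt m * q) \<le> real (hgt n)" by simp
    then have hq: "hgt m * q \<le> hgt n" by (simp only: of_nat_le_iff)
    \<comment> \<open>The cells of scale \<open>n\<close> inside \<open>cell m i\<close> are those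
      whose index has quotient \<open>i\<close>; all of them except \<open>b\<close> itself make up
      the difference.\<close>
    define I where "I = {l. l div q = i \<and> l \<noteq> j}"
    have I_less: "l < hgt n" if "l \<in> I" for l
    proof -
      have "l < (i + 1) * q" using that q0 dividend_less_div_times[of q l] by (auto simp: I_def)
      also have "\<dots> \<le> hgt m * q" using a(2) by (intro mult_le_mono) auto
      finally show ?thesis using hq by simp
    qed
    define C where "C = (\<lambda>l. cell n l - cut_points) ` I"
    have "finite I" using I_less by (meson bounded_nat_set_is_finite)
    then have "finite C" by (simp add: C_def)
    moreover have "C \<subseteq> insert {} pure_cells" using I_less by (auto simp: C_def pure_cells_def)
    moreover have "disjoint C" using cell_unique unfolding C_def disjoint_def by blast
    moreover have "a - b = \<Union>C"
    proof (intro equalityI subsetI)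
      fix x assume x: "x \<in> a - b"
      then have "x \<in> cell m i" "x \<notin> cut_points" "x \<notin> cell n j" by (auto simp: a b)
      moreover from this obtain l where "x \<in> cell n l" "l div q = i"
        using cell_refine[OF q] not_cut_point by metis
      ultimately show "x \<in> \<Union>C" by (auto simp: C_def I_def)
    next
      fix x assume "x \<in> \<Union>C"
      then obtain l where "l div q = i" "l \<noteq> j" "x \<in> cell n l" "x \<notin> cut_points" by (auto simp: C_def I_def)
      then show "x \<in> a - b" using cell_div[OF q] cell_unique by (auto simp: a b)
    qed
    ultimately show ?thesis by blast
  qed
qed

text \<open>Cell lengths tend to 0 because \<open>m < den m\<close>, so a small enough cell around a
  point of \<open>U\<close> stays in \<open>U\<close>. With only countably many cells, open sets are
  thereby generated.\<close>

lemma open_Int_pure: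
  assumes U: "open U"
  shows "(X - cut_points) \<inter> U = \<Union>{S \<in> pure_cells. S \<subseteq> U}"
proof (intro equalityI subsetI)
  fix x assume x: "x \<in> (X - cut_points) \<inter> U"
  then obtain m where m: "0 < x" "x < reach m" using in_X_reach[of x] by auto
  obtain e where e: "0 < e" "\<And>y. dist y x < e \<Longrightarrow> y \<in> U" using U x by (auto simp: open_dist)
  obtain k where k: "1 / real (Suc k) < e" using e(1) nat_approx_posE by blast
  define M where "M = max m k"
  have "x < reach M" using m reach_mono[of m M] by (simp add: M_def)
  then obtain i where i: "i < hgt M" "x \<in> cell M i"
    using in_some_cell_below[of x M] m(1) x not_cut_point by blast
  have "k < den M" using less_den[of M] by (simp add: M_def)
  then have "1 / real (den M) \<le> 1 / real (Suc k)" by (intro divide_left_mono) auto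
  then have w: "1 / den M < e" using k by simp
  have "cell M i \<subseteq> U"
  proof
    fix y assume "y \<in> cell M i"
    then have "dist y x < 1 / den M"
      using i(2) by (auto simp: cell_def dist_real_def add_divide_distrib)
    then show "y \<in> U" using e(2) w by simp
  qed
  then show "x \<in> \<Union>{S \<in> pure_cells. S \<subseteq> U}" using x i by (auto simp: pure_cells_def)
qed (use pure_cells_subset in blast)

lemma countable_pure_cells: "countable pure_cells"
proof -
  have "pure_cells \<subseteq> (\<lambda>(m, i). cell m i - cut_points) ` UNIV" by (auto simp: pure_cells_def)
  then show ?thesis by (rule countable_subset) simp
qed

lemma sigma_sets_pure_cells:
  "sigma_sets (X - cut_points) pure_cells = sets (restrict_space borel (X - cut_points))"
proof -
  let ?Y = "X - cut_points"
  have cut: "cut_points \<in> sets borel" using countable_cut_points sets.countable[of cut_points borel] by auto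
  have Y: "?Y \<in> sets borel" using X_borel cut by auto
  \<comment> \<open>The trace of a generated sigma-algebra is generated by the traces of the
    generators, here of the open sets.\<close>
  have "sets (restrict_space borel ?Y) = (\<inter>) ?Y ` sigma_sets UNIV {S. open S}"
    by (simp add: sets_restrict_space borel_def)
  also have "\<dots> = sigma_sets ?Y ((\<inter>) ?Y ` {S. open S})"
    using Y by (intro sigma_sets_Int) (auto simp: borel_def)
  also have "\<dots> = sigma_sets ?Y pure_cells"
  proof (intro sigma_sets_eqI)
    fix S assume "S \<in> (\<inter>) ?Y ` {S. open S}"
    then obtain U where U: "S = ?Y \<inter> U" "open U" by blast
    have "countable {S \<in> pure_cells. S \<subseteq> U}" using countable_pure_cells by (rule countable_subset[rotated]) auto
    then show "S \<in> sigma_sets ?Y pure_cells"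
      unfolding U(1) open_Int_pure[OF U(2)] by (rule sigma_sets_UNION) auto
  next
    fix S assume "S \<in> pure_cells"
    then obtain m i where "S = cell m i - cut_points" "i < hgt m" by (auto simp: pure_cells_def)
    then have "S = ?Y \<inter> cell m i" by (auto simp: X_def levels_col)
    moreover have "open (cell m i)" by (simp add: cell_def)
    ultimately show "S \<in> sigma_sets ?Y ((\<inter>) ?Y ` {S. open S})" by (intro sigma_sets.Basic) auto
  qed
  finally show ?thesis ..
qed

lemma generating_semiring_col: "generating_semiring col"
  unfolding generating_semiring_def X_def[symmetric] X_diff_endpoints levels_diff_endpoints Let_def
  using semiring_pure_cells sigma_sets_pure_cells by simp

theorem theorem5p2:
  "\<exists>(X :: real set) (T :: real \<Rightarrow> real).
     rank_one_transformation X T \<and>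
     zero_type (restrict_space lborel X) T \<and>
     \<not> rationally_weakly_mixing (restrict_space lborel X) T"
proof (intro exI conjI)
  have "\<forall>n. \<forall>(x, y) \<in> column_map (col n). T x = y" using T_eq by auto
  then show "rank_one_transformation X T"
    unfolding rank_one_transformation_def
    by (intro exI[of _ cuts] exI[of _ spacers] exI[of _ col] conjI cutting_and_stacking_col
        generating_semiring_col X_def T_in_X)
qed (rule zero_type_T not_rationally_weakly_mixing_T)+

end
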